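(* Let $q=3^m$ with $m\ge1$, let $\lambda$ be a non-square in $\mathbb{F}_q$, and let $$Q=\{(x,y,x^2-\lambda y^2)\mid x,y\in\mathbb{F}_q\}\subset\mathbb{F}_q^3.$$ Then $Q$, viewed as a subset of $\mathbb{F}_3^{3m}$, is a complete capset.
   Context: A capset is a subset of $\mathbb{F}_3^n$ containing no three distinct points on a common affine line over $\mathbb{F}_3$ (equivalently, no three distinct points summing to $0$). A capset is complete if it is not a proper subset of a larger capset. Choosing a basis of $\mathbb{F}_q$ over $\mathbb{F}_3$ identifies $\mathbb{F}_q^3$ with $\mathbb{F}_3^{3m}$ as $\mathbb{F}_3$-vector spaces; the properties above do not depend on the choice of basis. *)

theory Defs
  imports "HOL-Analysis.Cartesian_Space" "HOL-Library.Product_Plus" "HOL-Number_Theory.Residues"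
begin

text \<open>The library's three-element field serves as the ground field; as everywhere in the library,
  the coordinate space of dimension \<open>CARD('n)\<close> over it is \<open>F3 ^ 'n\<close>.\<close>

type_synonym F3 = Enum.finite_3

lemma F3_cases: "(c::F3) = 0 \<or> c = 1 \<or> c = - 1"
  by (cases c) (auto simp: uminus_finite_3_def)

lemma F3_facts: "(1::F3) + 1 = - 1" "(1::F3) \<noteq> - 1" "card (UNIV :: F3 set) = 3"
  by (auto simp: plus_finite_3_def uminus_finite_3_def UNIV_finite_3)

definition affine_line :: "(F3 ^ 'n) set \<Rightarrow> bool" where
  "affine_line L \<longleftrightarrow> (\<exists>a d. d \<noteq> 0 \<and> L = range (\<lambda>t. a + t *s d))"

definition capset :: "(F3 ^ 'n) set \<Rightarrow> bool" where
  "capset C \<longleftrightarrow>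
     \<not> (\<exists>L x y z. affine_line L \<and> {x, y, z} \<subseteq> C \<inter> L \<and> x \<noteq> y \<and> x \<noteq> z \<and> y \<noteq> z)"

definition complete_capset :: "(F3 ^ 'n) set \<Rightarrow> bool" where
  "complete_capset C \<longleftrightarrow> capset C \<and> \<not> (\<exists>D. capset D \<and> C \<subset> D)"

text \<open>Scalar multiplication by the three-element field on an abelian group of exponent 3, such as
  the additive group of a field of characteristic 3 or a power of it.  The third scalar is
  \<open>2 = - 1\<close>.\<close>

definition scaleF3 :: "F3 \<Rightarrow> 'v::ab_group_add \<Rightarrow> 'v" where
  "scaleF3 c v = (if c = 0 then 0 else if c = 1 then v else - v)"

text \<open>An identification of the cube of \<open>'q\<close> with a coordinate space over the three-element field:
  an isomorphism of vector spaces.  The ones obtained by choosing a basis of \<open>'q\<close> and expanding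
  each of the three components in it are of this form.\<close>

definition F3_identification :: "('q::{field,finite} \<times> 'q \<times> 'q \<Rightarrow> F3 ^ 'n) \<Rightarrow> bool" where
  "F3_identification \<phi> \<longleftrightarrow> Vector_Spaces.linear scaleF3 (*s) \<phi> \<and> bij \<phi>"

definition paraboloid :: "'q::{field,finite} \<Rightarrow> ('q \<times> 'q \<times> 'q) set" where
  "paraboloid l = {(x, y, x\<^sup>2 - l * y\<^sup>2) | x y. True}"


section \<open>Basic facts and existence of identifications\<close>

lemma scaleF3_simps [simp]: "scaleF3 0 v = 0" "scaleF3 1 v = v" "scaleF3 (- 1) v = - v"
  using F3_facts(2) by (auto simp: scaleF3_def simp del: zero_finite_3_def one_finite_3_def)

lemma scaleF3_vec: "scaleF3 c v = c *s (v :: F3 ^ 'n)"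
  using F3_cases[of c]
  by (auto simp: vec_eq_iff simp del: zero_finite_3_def one_finite_3_def)

lemma vector_space_scaleF3:
  assumes "\<And>v::'v::ab_group_add. v + v + v = 0"
  shows "vector_space (scaleF3 :: F3 \<Rightarrow> 'v \<Rightarrow> 'v)"
proof -
  have *: "v + v = - v" for v :: 'v
    using assms[of v] by (simp add: eq_neg_iff_add_eq_0)
  have **: "- v - v = v" for v :: 'v
    using *[of v] by (metis minus_add_distrib minus_minus diff_conv_add_uminus)
  have m: "- (2::F3) = 1"
    by (simp add: uminus_finite_3_def)
  show ?thesis
  proof
    fix a b :: F3 and x y :: 'v
    show "scaleF3 a (x + y) = scaleF3 a x + scaleF3 a y"
      using F3_cases[of a] by (auto simp del: zero_finite_3_def one_finite_3_def)
    show "scaleF3 (a + b) x = scaleF3 a x + scaleF3 b x"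
      using F3_cases[of a] F3_cases[of b]
      by (elim disjE) (simp_all add: F3_facts(1) m * ** del: zero_finite_3_def one_finite_3_def add_uminus_conv_diff one_add_one two_finite_3)
    show "scaleF3 a (scaleF3 b x) = scaleF3 (a * b) x"
      using F3_cases[of a] F3_cases[of b]
      by (elim disjE) (simp_all del: zero_finite_3_def one_finite_3_def)
    show "scaleF3 1 x = x"
      by (simp del: one_finite_3_def)
  qed
qed

lemma capset_iff_sum:
  "capset C \<longleftrightarrow> \<not> (\<exists>x\<in>C. \<exists>y\<in>C. \<exists>z\<in>C. x \<noteq> y \<and> x \<noteq> z \<and> y \<noteq> z \<and> x + y + z = (0 :: F3 ^ 'n))"
proof -
  have three: "x + x + x = 0" for x :: F3
    by (cases x) (auto simp: plus_finite_3_def)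
  have v3: "v + v + v = 0" for v :: "F3 ^ 'n"
    by (simp only: vec_eq_iff vector_add_component three zero_index) simp
  have rng: "range (\<lambda>t. a + t *s d) = {a, a + d, a - d}" for a d :: "F3 ^ 'n"
  proof -
    have U: "(UNIV :: F3 set) = {0, 1, - 1}" using F3_cases by blast
    have "(- 1) *s d = - d" by (rule vector_sneg_minus1[symmetric])
    then show ?thesis
      by (simp only: U image_insert image_empty vector_smult_lzero vector_smult_lid add_0_right
          diff_conv_add_uminus)
  qed
  have "(\<exists>L. affine_line L \<and> {x, y, z} \<subseteq> L) \<longleftrightarrow> x + y + z = 0"
    if d: "x \<noteq> y" "x \<noteq> z" "y \<noteq> z" for x y z :: "F3 ^ 'n"
  proof
    assume "\<exists>L. affine_line L \<and> {x, y, z} \<subseteq> L"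
    then obtain a d where "{x, y, z} \<subseteq> {a, a + d, a - d}"
      unfolding affine_line_def rng by blast
    moreover have "card {x, y, z} = 3" using d by simp
    moreover have "card {a, a + d, a - d} \<le> 3"
      by (simp add: card_insert_if)
    ultimately have eq: "{x, y, z} = {a, a + d, a - d}"
      by (metis card_seteq finite.emptyI finite.insertI)
    then have "card {a, a + d, a - d} = 3" using \<open>card {x, y, z} = 3\<close> by simp
    then have "a \<noteq> a + d" "a \<noteq> a - d" "a + d \<noteq> a - d"
      by (auto simp: card_insert_if split: if_splits)
    then have "\<Sum>{a, a + d, a - d} = a + a + a" by simp
    moreover have "\<Sum>{x, y, z} = x + y + z" using d by (simp add: add.assoc)
    ultimately show "x + y + z = 0" using eq v3[of a] by simp
  next
    assume s: "x + y + z = 0"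
    have "x - (y - x) - z = (x + x + x) - (x + y + z)"
      by (simp only: diff_conv_add_uminus minus_add_distrib minus_minus ac_simps)
        (simp add: add.assoc[symmetric])
    then have "x - (y - x) = z"
      by (simp only: s v3) simp
    then have "{x, y, z} \<subseteq> range (\<lambda>t. x + t *s (y - x))" unfolding rng by auto
    moreover have "y - x \<noteq> 0" using d by simp
    ultimately show "\<exists>L. affine_line L \<and> {x, y, z} \<subseteq> L"
      unfolding affine_line_def by blast
  qed
  note key = this
  have "\<not> capset C \<longleftrightarrow>
    (\<exists>x\<in>C. \<exists>y\<in>C. \<exists>z\<in>C. x \<noteq> y \<and> x \<noteq> z \<and> y \<noteq> z \<and> x + y + z = 0)"
  proof
    assume "\<exists>x\<in>C. \<exists>y\<in>C. \<exists>z\<in>C. x \<noteq> y \<and> x \<noteq> z \<and> y \<noteq> z \<and> x + y + z = 0"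
    then obtain x y z where C: "x \<in> C" "y \<in> C" "z \<in> C" and d: "x \<noteq> y" "x \<noteq> z" "y \<noteq> z"
      and "x + y + z = 0"
      by blast
    then obtain L where "affine_line L" "{x, y, z} \<subseteq> L" using key[OF d] by blast
    then have "affine_line L \<and> {x, y, z} \<subseteq> C \<inter> L \<and> x \<noteq> y \<and> x \<noteq> z \<and> y \<noteq> z"
      using C d by simp
    then show "\<not> capset C" unfolding capset_def not_not by (intro exI)
  next
    assume "\<not> capset C"
    then obtain L x y z where L: "affine_line L" "{x, y, z} \<subseteq> C \<inter> L"
      and d: "x \<noteq> y" "x \<noteq> z" "y \<noteq> z"
      unfolding capset_def not_not by (elim exE conjE)
    then have "{x, y, z} \<subseteq> L" by simp
    with L(1) have "x + y + z = 0" using key[OF d] by metis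
    moreover have "x \<in> C" "y \<in> C" "z \<in> C" using L(2) by simp_all
    ultimately show "\<exists>x\<in>C. \<exists>y\<in>C. \<exists>z\<in>C. x \<noteq> y \<and> x \<noteq> z \<and> y \<noteq> z \<and> x + y + z = 0"
      using d by metis
  qed
  then show ?thesis by metis
qed

lemma F3_identification_exists:
  assumes q: "CARD('q::{field,finite}) = 3 ^ m" and n: "CARD('n::finite) = 3 * m"
  shows "\<exists>\<phi> :: 'q \<times> 'q \<times> 'q \<Rightarrow> F3 ^ 'n. F3_identification \<phi>"
proof -
  have "CHAR('q) dvd 3 ^ m" using CHAR_dvd_CARD[where 'a = 'q] q by simp
  moreover have "prime CHAR('q)"
    using prime_CHAR_semidom[where 'a = 'q] finite_imp_CHAR_pos[where 'a = 'q] by simp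
  ultimately have "CHAR('q) dvd 3"
    using prime_dvd_power by blast
  then have "of_nat 3 = (0::'q)"
    using of_nat_eq_0_iff_char_dvd by blast
  moreover have "x + x + x = of_nat 3 * x" for x :: 'q
    by (simp add: algebra_simps)
  ultimately have "x + x + x = 0" for x :: 'q
    by simp
  then have v3: "v + v + v = 0" for v :: "'q \<times> 'q \<times> 'q"
    by (simp only: prod_eq_iff fst_add snd_add fst_zero snd_zero)
  interpret V: vector_space "scaleF3 :: F3 \<Rightarrow> 'q \<times> 'q \<times> 'q \<Rightarrow> 'q \<times> 'q \<times> 'q"
    by (rule vector_space_scaleF3) (rule v3)
  obtain B where B: "V.independent B" "V.span B = UNIV"
    using V.maximal_independent_subset[of UNIV] by (metis top.extremum_uniqueI)
  have inj: "v = w" if "\<And>b. b \<in> B \<Longrightarrow> V.representation B v b = V.representation B w b" for v w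
  proof -
    have "V.representation B v = V.representation B w"
      using that V.representation_ne_zero[of B] by (metis ext)
    then show ?thesis
      using V.sum_nonzero_representation_eq[OF B(1), of v]
        V.sum_nonzero_representation_eq[OF B(1), of w] B(2) by simp
  qed
  have card_fun: "card (B \<rightarrow>\<^sub>E (UNIV :: F3 set)) = 3 ^ card B"
    by (simp add: card_PiE F3_facts(3))
  have "bij_betw (\<lambda>v. restrict (V.representation B v) B) UNIV (B \<rightarrow>\<^sub>E UNIV)"
  proof (rule bij_betwI')
    fix f :: "'q \<times> 'q \<times> 'q \<Rightarrow> F3"
    assume f: "f \<in> B \<rightarrow>\<^sub>E UNIV"
    define v where "v = (\<Sum>b\<in>B. scaleF3 (f b) b)"
    have "V.representation B v b = f b" if "b \<in> B" for b
    proof -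
      have "V.representation B v b = (\<Sum>c\<in>B. f c * V.representation B c b)"
        unfolding v_def using B
        by (simp add: V.representation_sum V.representation_scale)
      also have "\<dots> = (\<Sum>c\<in>B. if c = b then f c else 0)"
        using B(1) by (intro sum.cong) (auto simp: V.representation_basis)
      also have "\<dots> = f b" using that by (subst sum.delta) auto
      finally show ?thesis .
    qed
    then show "\<exists>v\<in>UNIV. f = restrict (V.representation B v) B"
      using f by (intro bexI[of _ v]) (auto simp: fun_eq_iff restrict_def PiE_def extensional_def)
  next
    fix v w
    show "(restrict (V.representation B v) B = restrict (V.representation B w) B) = (v = w)"
      using inj by (metis restrict_apply')
  qed auto
  then have "CARD('q \<times> 'q \<times> 'q) = 3 ^ card B"
    using card_fun bij_betw_same_card by metis
  then have "(3::nat) ^ card B = 3 ^ CARD('n)"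
    using q n by (simp add: power_add mult_2 numeral_3_eq_3)
  then have cB: "card B = CARD('n)" by (simp add: power_inject_exp)
  then obtain e where e: "bij_betw e (UNIV :: 'n set) B"
    using finite_same_card_bij[of "UNIV :: 'n set" B] by auto
  define \<phi> :: "'q \<times> 'q \<times> 'q \<Rightarrow> F3 ^ 'n" where "\<phi> v = (\<chi> i. V.representation B v (e i))" for v
  have lin: "Vector_Spaces.linear scaleF3 (*s) \<phi>"
    using B
    by unfold_locales (auto simp: \<phi>_def vec_eq_iff V.representation_add V.representation_scale)
  have "inj \<phi>"
  proof (rule injI)
    fix v w assume "\<phi> v = \<phi> w"
    then have "V.representation B v (e i) = V.representation B w (e i)" for i
      by (simp add: \<phi>_def vec_eq_iff)
    then show "v = w" using inj e by (metis bij_betw_def imageE)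
  qed
  moreover have "CARD('q \<times> 'q \<times> 'q) = CARD(F3 ^ 'n)"
    using \<open>CARD('q \<times> 'q \<times> 'q) = 3 ^ card B\<close> cB by (simp add: CARD_vec F3_facts(3))
  ultimately have "bij \<phi>"
    by (metis bij_betw_def card_image card_subset_eq finite subset_UNIV)
  with lin show ?thesis unfolding F3_identification_def by blast
qed

end

theory Submission
  imports Defs
begin

text \<open>
  Put \<open>N(x, y) = x\<^sup>2 - \<lambda>y\<^sup>2\<close>; this form is anisotropic since \<open>\<lambda>\<close> is a non-square, and it represents
  every element of the field by a pigeonhole argument on squares.  In characteristic 3 three points
  \<open>p, q, r\<close> of the plane with \<open>p + q + r = 0\<close> satisfy \<open>N(p) + N(q) + N(r) = - N(p - q)\<close>, so three
  points of \<open>Q\<close> with sum 0 coincide.  If \<open>(u, z)\<close> is not on \<open>Q\<close>, choose \<open>d\<close> with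
  \<open>N(d) = z - N(u) \<noteq> 0\<close>; then the points of \<open>Q\<close> above \<open>u + d\<close> and \<open>u - d\<close> are distinct and have
  sum 0 with \<open>(u, z)\<close>.
\<close>

text \<open>Squaring has one root above 0 and at most two above any other square, so summing over
  its fibres bounds the size of the field.\<close>

lemma card_squares_ge:
  "CARD('q::{idom,finite}) + 1 \<le> 2 * card (range (\<lambda>x::'q. x\<^sup>2))"
proof -
  let ?S = "range (\<lambda>x::'q. x\<^sup>2)"
  have fibre: "card {x::'q. x\<^sup>2 = s} \<le> (if s = 0 then 1 else 2)" if s: "s \<in> ?S" for s
  proof -
    obtain t where "s = t\<^sup>2" using s by blast
    then have "{x. x\<^sup>2 = s} = {t, - t}" by (auto simp: power2_eq_iff)
    then show ?thesis using \<open>s = t\<^sup>2\<close> by (auto simp: card_insert_if)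
  qed
  have 0: "(0::'q) \<in> ?S" by (auto simp: image_iff intro: exI[of _ 0])
  \<comment> \<open>Positivity keeps the natural-number subtraction \<open>card ?S - 1\<close> below
    from truncating.\<close>
  then have pos: "card ?S > 0" by (auto simp: card_gt_0_iff)
  have "CARD('q) = card (\<Union>s\<in>?S. {x::'q. x\<^sup>2 = s})" by (rule arg_cong[of _ _ card]) auto
  also have "\<dots> \<le> (\<Sum>s\<in>?S. card {x::'q. x\<^sup>2 = s})" by (rule card_UN_le) simp
  also have "\<dots> \<le> (\<Sum>s\<in>?S. if s = 0 then 1 else 2)" by (rule sum_mono) (rule fibre)
  also have "\<dots> = 1 + (\<Sum>s\<in>?S - {0}. if s = 0 then 1 else 2)"
    using 0 by (subst sum.remove[of _ 0]) auto
  also have "\<dots> = 1 + 2 * (card ?S - 1)"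
    using 0 by (simp add: card_Diff_singleton)
  finally show ?thesis using pos by linarith
qed

text \<open>The squares and their image under the injective map \<open>s\<close> to
  \<open>c + l * s\<close> each fill more than half of the field, so they meet.\<close>

lemma norm_form_surj:
  fixes l c :: "'q::{field,finite}"
  assumes "l \<noteq> 0"
  obtains x y where "x\<^sup>2 - l * y\<^sup>2 = c"
proof -
  let ?S = "range (\<lambda>x::'q. x\<^sup>2)" and ?T = "range (\<lambda>y::'q. c + l * y\<^sup>2)"
  have "?T = (\<lambda>s. c + l * s) ` ?S" by auto
  moreover have "inj_on (\<lambda>s. c + l * s) ?S" using assms by (auto simp: inj_on_def)
  ultimately have "card ?T = card ?S" by (simp add: card_image)
  moreover have "card (?S \<union> ?T) \<le> CARD('q)" by (rule card_mono) auto
  ultimately have "card (?S \<union> ?T) < card ?S + card ?T"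
    using card_squares_ge[where 'q = 'q] by linarith
  then have "?S \<inter> ?T \<noteq> {}" using card_Un_disjoint[of ?S ?T] by fastforce
  then obtain x y where "x\<^sup>2 = c + l * y\<^sup>2" by auto
  then show ?thesis using that by (simp add: algebra_simps)
qed

text \<open>A zero with \<open>y\<close> nonzero would exhibit \<open>l\<close> as the square of
  \<open>x / y\<close>.\<close>

lemma norm_form_anisotropic:
  fixes l x y :: "'q::field"
  assumes "\<nexists>z. l = z\<^sup>2" and "x\<^sup>2 - l * y\<^sup>2 = 0"
  shows "x = 0" "y = 0"
proof -
  show "y = 0"
  proof (rule ccontr)
    assume "y \<noteq> 0"
    then have "l = (x / y)\<^sup>2" using assms(2) by (simp add: field_simps)
    then show False using assms(1) by blast
  qed
  then show "x = 0" using assms(2) by simp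
qed

lemma in_paraboloid_iff: "(x, y, z) \<in> paraboloid l \<longleftrightarrow> z = x\<^sup>2 - l * y\<^sup>2"
  by (auto simp: paraboloid_def)

lemma vec_F3_triple: "v + v + v = (0 :: F3 ^ 'n)"
proof -
  have "x + x + x = 0" for x :: F3
    by (cases x) (auto simp: plus_finite_3_def)
  then show ?thesis by (simp only: vec_eq_iff vector_add_component zero_index) simp
qed

lemma paraboloid_sum_zero_imp_eq:
  fixes l :: "'q::{field,finite}"
  assumes three: "(3::'q) = 0" and l: "\<nexists>z. l = z\<^sup>2"
    and P: "P \<in> paraboloid l" and Q: "Q \<in> paraboloid l" and R: "R \<in> paraboloid l"
    and sum: "P + Q + R = 0"
  shows "P = Q"
proof -
  obtain x y where p: "P = (x, y, x\<^sup>2 - l * y\<^sup>2)" using P by (auto simp: paraboloid_def)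
  obtain x' y' where q: "Q = (x', y', x'\<^sup>2 - l * y'\<^sup>2)" using Q by (auto simp: paraboloid_def)
  obtain x'' y'' where r: "R = (x'', y'', x''\<^sup>2 - l * y''\<^sup>2)" using R by (auto simp: paraboloid_def)
  have s: "x + x' + x'' = 0" "y + y' + y'' = 0"
    "x\<^sup>2 - l * y\<^sup>2 + (x'\<^sup>2 - l * y'\<^sup>2) + (x''\<^sup>2 - l * y''\<^sup>2) = 0"
    using sum unfolding p q r by (simp_all add: zero_prod_def)
  have xy: "x'' = - (x + x')" "y'' = - (y + y')"
    using s(1,2) by (metis add_eq_0_iff)+
  \<comment> \<open>The parallelogram law N(p - q) + N(p + q) = 2 N(p) + 2 N(q), where N(p + q) =
    N(r) because r = -(p + q).\<close>
  have "(x - x')\<^sup>2 - l * (y - y')\<^sup>2 =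
      3 * (x\<^sup>2 + x'\<^sup>2 - l * (y\<^sup>2 + y'\<^sup>2))
      - (x\<^sup>2 - l * y\<^sup>2 + (x'\<^sup>2 - l * y'\<^sup>2) + (x''\<^sup>2 - l * y''\<^sup>2))"
    unfolding xy by (simp add: algebra_simps power2_eq_square)
  also have "\<dots> = 0" by (simp add: three s(3))
  finally have "x - x' = 0" "y - y' = 0"
    using norm_form_anisotropic[OF l] by blast+
  then show ?thesis by (simp add: p q)
qed

lemma paraboloid_completes:
  fixes l :: "'q::{field,finite}"
  assumes three: "(3::'q) = 0" and l: "l \<noteq> 0" and R: "R \<notin> paraboloid l"
  obtains P Q where "P \<in> paraboloid l" "Q \<in> paraboloid l" "P \<noteq> Q" "P + Q + R = 0"
proof -
  obtain x y z where r: "R = (x, y, z)" by (cases R)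
  obtain a b where ab: "a\<^sup>2 - l * b\<^sup>2 = z - (x\<^sup>2 - l * y\<^sup>2)"
    using norm_form_surj[OF l] by blast
  have nz: "a \<noteq> 0 \<or> b \<noteq> 0" using ab R by (auto simp: r in_paraboloid_iff)
  let ?P = "(x + a, y + b, (x + a)\<^sup>2 - l * (y + b)\<^sup>2)"
  let ?Q = "(x - a, y - b, (x - a)\<^sup>2 - l * (y - b)\<^sup>2)"
  \<comment> \<open>Negation fixes only 0 in characteristic 3; this separates u + d from u - d when
    d is nonzero.\<close>
  have double: "c = 0" if "c = - c" for c :: 'q
  proof -
    have "c = 3 * c - (c + c)" by (simp add: algebra_simps)
    also have "c + c = 0" using that by (simp add: eq_neg_iff_add_eq_0)
    finally show ?thesis by (simp add: three)
  qed
  have "?P \<noteq> ?Q"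
  proof
    assume "?P = ?Q"
    then have "a = - a" "b = - b" by (simp_all add: diff_conv_add_uminus del: add_uminus_conv_diff)
    then show False using nz double by blast
  qed
  moreover have "?P + ?Q + R = 0"
  proof -
    \<comment> \<open>The parallelogram law again: the sum is 2 N(u) + 2 N(d) + z, and N(d) = z -
      N(u) turns it into 3z.\<close>
    have "(x + a)\<^sup>2 - l * (y + b)\<^sup>2 + ((x - a)\<^sup>2 - l * (y - b)\<^sup>2) + z =
      3 * z + 2 * ((a\<^sup>2 - l * b\<^sup>2) - (z - (x\<^sup>2 - l * y\<^sup>2)))"
      by (simp add: algebra_simps power2_eq_square)
    moreover have "x + a + (x - a) + x = 3 * x" "y + b + (y - b) + y = 3 * y"
      by (simp_all add: algebra_simps)
    ultimately show ?thesis by (simp add: r zero_prod_def three ab)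
  qed
  ultimately show ?thesis using that[of ?P ?Q] by (simp add: in_paraboloid_iff)
qed

theorem theorem2p6:
  fixes m :: nat
    and l :: "'q::{field,finite}"
    and \<phi> :: "'q \<times> 'q \<times> 'q \<Rightarrow> F3 ^ 'n"
  assumes "m \<ge> 1"
    and "CARD('q) = 3 ^ m"
    and "CARD('n) = 3 * m"
    and "\<nexists>z. l = z\<^sup>2"
    and "F3_identification \<phi>"
  shows "complete_capset (\<phi> ` paraboloid l)"
proof -
  interpret Vector_Spaces.linear scaleF3 "(*s)" \<phi>
    using assms(5) unfolding F3_identification_def by blast
  have inj: "inj \<phi>" and surj: "surj \<phi>"
    using assms(5) unfolding F3_identification_def by (auto simp: bij_def)
  have sum0: "\<phi> P + \<phi> Q + \<phi> R = 0 \<longleftrightarrow> P + Q + R = 0" for P Q R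
  proof -
    have "\<phi> P + \<phi> Q + \<phi> R = \<phi> (P + Q + R)" by (simp only: add)
    then show ?thesis using inj by (metis injD zero)
  qed
  \<comment> \<open>Characteristic 3 is pulled back along the injective linear map
    \<open>\<phi>\<close> from its codomain, where tripling kills every vector.\<close>
  have "(1, 0, 0) + (1, 0, 0) + (1, 0, 0) = (0 :: 'q \<times> 'q \<times> 'q)"
    using sum0 vec_F3_triple by blast
  then have three: "(3::'q) = 0" by (simp add: zero_prod_def)
  have l0: "l \<noteq> 0" using assms(4) by (metis zero_power2)
  show ?thesis
    unfolding complete_capset_def
  proof
    show "capset (\<phi> ` paraboloid l)"
      unfolding capset_iff_sum using paraboloid_sum_zero_imp_eq[OF three assms(4)] sum0 by blast
    show "\<not> (\<exists>D. capset D \<and> \<phi> ` paraboloid l \<subset> D)"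
    proof
      assume "\<exists>D. capset D \<and> \<phi> ` paraboloid l \<subset> D"
      then obtain D w where D: "capset D" "\<phi> ` paraboloid l \<subseteq> D" and w: "w \<in> D" "w \<notin> \<phi> ` paraboloid l"
        by blast
      obtain R where R: "w = \<phi> R" using surj by blast
      with w(2) have "R \<notin> paraboloid l" by blast
      then obtain P Q where PQ: "P \<in> paraboloid l" "Q \<in> paraboloid l" "P \<noteq> Q" "P + Q + R = 0"
        using paraboloid_completes[OF three l0] by blast
      have "\<phi> P \<noteq> \<phi> Q" using inj PQ(3) by (metis injD)
      \<comment> \<open>Both images lie in the image of the paraboloid, which \<open>w\<close>
        avoids.\<close>
      moreover have "\<phi> P \<noteq> w" "\<phi> Q \<noteq> w" using PQ(1,2) w(2) by blast+
      moreover have "\<phi> P \<in> D" "\<phi> Q \<in> D" using PQ(1,2) D(2) by blast+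
      moreover have "\<phi> P + \<phi> Q + w = 0" using sum0 PQ(4) R by metis
      ultimately show False using D(1) w(1) unfolding capset_iff_sum by blast
    qed
  qed
qed

end
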